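(* Let $n\ge 1$ be an integer, let $\mathbf p=(p_1,\dots,p_n)\in[0,1]^n$, and consider the fully symmetric $n$-player model with parameter $\mathbf p$. The following are equivalent: (i) for every $1\le i\le n$, the cause $C_i$ influences the effect $E_i$; (ii) for every $1\le i,j\le n$, the cause $C_i$ influences the effect $E_j$; (iii) there exists $s\in\{1,\dots,n\}$ such that $p_s\ne p_{n-s+1}$.
   Context: Fully symmetric (GST) model with parameter $\mathbf p\in[0,1]^n$: $C_1,\dots,C_n$ (causes) are mutually independent $\{0,1\}$-valued random variables with $\mathbb P(C_i=1)=1/2$; $E_1,\dots,E_n$ (effects) are $\{0,1\}$-valued random variables that are conditionally independent given the joint outcome of all the causes, with $$\mathbb P\Big(E_i=1\;\Big|\;\bigwedge_{j=1}^n C_j=x_j\Big)=p_k,\qquad k=\#\{j\in\{1,\dots,n\}: x_j=x_i\},$$ for every $(x_1,\dots,x_n)\in\{0,1\}^n$. A cause $C_j$ influences an effect $E_i$ if there exists an assignment of states to the remaining $n-1$ causes such that changing the state of $C_j$, with the remaining causes held at that assignment, changes the conditional probability (given the states of all causes) that $E_i=1$. *)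

theory Defs
  imports "HOL-Probability.Probability"
begin

definition causes_event ::
  "'a measure \<Rightarrow> nat \<Rightarrow> (nat \<Rightarrow> 'a \<Rightarrow> nat) \<Rightarrow> (nat \<Rightarrow> nat) \<Rightarrow> 'a set" where
  "causes_event M n C x = {\<omega> \<in> space M. \<forall>j\<in>{1..n}. C j \<omega> = x j}"

text \<open>
  Conditional independence of the effects given the outcome \<open>x\<close> of all causes is mutual
  independence under the conditional measure; \<open>uniform_measure M A\<close> is \<open>M\<close> conditioned on
  \<open>A\<close>. Every joint outcome of the causes has probability \<open>1 / 2 ^ n\<close>, so no conditioning
  event is null.
\<close>

locale fully_symmetric_model = prob_space M
  for M :: "'a measure" +
  fixes n :: nat
    and p :: "nat \<Rightarrow> real"
    and C E :: "nat \<Rightarrow> 'a \<Rightarrow> nat"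
  assumes causes_indep: "indep_vars (\<lambda>_. count_space {0, 1}) C {1..n}"
    and causes_fair: "\<And>i. i \<in> {1..n} \<Longrightarrow> \<P>(\<omega> in M. C i \<omega> = 1) = 1 / 2"
    and effects_rv: "\<And>i. i \<in> {1..n} \<Longrightarrow> random_variable (count_space {0, 1}) (E i)"
    and effects_cond_indep:
      "\<And>x. x \<in> {1..n} \<rightarrow>\<^sub>E {0, 1} \<Longrightarrow>
        prob_space.indep_vars (uniform_measure M (causes_event M n C x))
          (\<lambda>_. count_space {0, 1}) E {1..n}"
    and effects_cond_prob:
      "\<And>x i. x \<in> {1..n} \<rightarrow>\<^sub>E {0, 1} \<Longrightarrow> i \<in> {1..n} \<Longrightarrow>
        \<P>(\<omega> in M. E i \<omega> = 1 \<bar> \<omega> \<in> causes_event M n C x) = p (card {j \<in> {1..n}. x j = x i})"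

definition influences ::
  "'a measure \<Rightarrow> nat \<Rightarrow> (nat \<Rightarrow> 'a \<Rightarrow> nat) \<Rightarrow> (nat \<Rightarrow> 'a \<Rightarrow> nat) \<Rightarrow> nat \<Rightarrow> nat \<Rightarrow> bool" where
  "influences M n C E j i \<longleftrightarrow>
    (\<exists>x \<in> ({1..n} - {j}) \<rightarrow>\<^sub>E {0, 1}.
      \<P>(\<omega> in M. E i \<omega> = 1 \<bar> \<omega> \<in> causes_event M n C (x(j := 0))) \<noteq>
      \<P>(\<omega> in M. E i \<omega> = 1 \<bar> \<omega> \<in> causes_event M n C (x(j := 1))))"

end

theory Submission
  imports Defs
begin

text \<open>
  Every conditional probability in the definition of influence is a value of \<open>p\<close>. If \<open>m\<close> of the
  causes other than \<open>i\<close> are \<open>0\<close>, flipping \<open>C i\<close> from \<open>0\<close> to \<open>1\<close> moves the parameter of \<open>E i\<close> from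
  \<open>p (m + 1)\<close> to \<open>p (n - m)\<close>, and every \<open>m < n\<close> occurs. If \<open>j \<noteq> i\<close>, flipping \<open>C j\<close> moves the
  parameter of \<open>E i\<close> between consecutive values \<open>p (m + 1)\<close> and \<open>p m\<close>, and every \<open>m\<close> from \<open>1\<close> to
  \<open>n - 1\<close> occurs; so a failure of \<open>p s = p (n - s + 1)\<close>, which makes \<open>p\<close> non-constant, yields an
  influence here as well.
\<close>

text \<open>If all consecutive values agreed between \<open>a\<close> and \<open>b\<close>, then
  \<open>f\<close> would be constant there; induction on \<open>b\<close> locates a jump.\<close>

lemma ex_consecutive_neq:
  fixes f :: "nat \<Rightarrow> 'b"
  assumes "a \<le> b" and "f a \<noteq> f b"
  obtains m where "a \<le> m" "m < b" "f m \<noteq> f (Suc m)"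
proof -
  have "\<exists>m. a \<le> m \<and> m < b \<and> f m \<noteq> f (Suc m)"
    using assms
  proof (induction b rule: dec_induct)
    case (step b)
    then show ?case
      by (cases "f a = f b") (auto intro: less_SucI)
  qed simp
  then show thesis
    using that by blast
qed

text \<open>Fixing \<open>C j\<close> completes \<open>x\<close> to a full outcome of the causes, so
  \<open>effects_cond_prob\<close> applies to both sides. What remains is counting.\<close>

lemma (in fully_symmetric_model) influences_iff:
  assumes "i \<in> {1..n}" and "j \<in> {1..n}"
  shows "influences M n C E j i \<longleftrightarrow>
    (\<exists>x \<in> ({1..n} - {j}) \<rightarrow>\<^sub>E {0 :: nat, 1}.
      p (card {l \<in> {1..n}. (x(j := 0)) l = (x(j := 0)) i}) \<noteq>
      p (card {l \<in> {1..n}. (x(j := 1)) l = (x(j := 1)) i}))"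
proof -
  have mem: "x(j := c) \<in> {1..n} \<rightarrow>\<^sub>E {0, 1}"
    if "x \<in> ({1..n} - {j}) \<rightarrow>\<^sub>E {0, 1}" and "c \<in> {0, 1}" for x :: "nat \<Rightarrow> nat" and c
    using that assms(2) by (auto simp: PiE_iff extensional_def)
  show ?thesis
    unfolding influences_def
    by (intro bex_cong refl) (simp only: effects_cond_prob[OF mem assms(1)] insert_iff simp_thms)
qed

text \<open>An assignment to the causes other than \<open>j\<close> is encoded by its zero set
  \<open>T\<close>. The pointwise form of \<open>x_T\<close> fits both a given \<open>x\<close> and
  one built from a chosen \<open>T\<close>.\<close>

context
  fixes n j :: nat and T :: "nat set" and x :: "nat \<Rightarrow> nat"
  assumes j: "j \<in> {1..n}"
    and T: "T \<subseteq> {1..n} - {j}"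
    and x_T: "\<And>l. l \<in> {1..n} - {j} \<Longrightarrow> x l = (if l \<in> T then 0 else 1)"
begin

lemma card_zeros_upd_0: "card {l \<in> {1..n}. (x(j := 0)) l = 0} = Suc (card T)"
proof -
  have "(x(j := 0)) l = 0 \<longleftrightarrow> l \<in> insert j T" if "l \<in> {1..n}" for l
    using x_T[of l] T that by auto
  then have "{l \<in> {1..n}. (x(j := 0)) l = 0} = insert j T"
    using j T by (auto simp: subset_iff simp del: fun_upd_apply)
  moreover have "finite T" "j \<notin> T"
    using T by (auto intro: finite_subset)
  ultimately show ?thesis by simp
qed

lemma card_zeros_upd_1: "card {l \<in> {1..n}. (x(j := 1)) l = 0} = card T"
proof -
  have "(x(j := 1)) l = 0 \<longleftrightarrow> l \<in> T" if "l \<in> {1..n}" for l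
    using x_T[of l] T that by auto
  then have "{l \<in> {1..n}. (x(j := 1)) l = 0} = T"
    using j T by (auto simp: subset_iff simp del: fun_upd_apply)
  then show ?thesis by simp
qed

lemma card_ones_upd_1: "card {l \<in> {1..n}. (x(j := 1)) l = 1} = n - card T"
proof -
  have "(x(j := 1)) l = 1 \<longleftrightarrow> l \<notin> T" if "l \<in> {1..n}" for l
    using x_T[of l] T that by auto
  then have "{l \<in> {1..n}. (x(j := 1)) l = 1} = {1..n} - T"
    using j T by (auto simp: subset_iff simp del: fun_upd_apply)
  moreover have "T \<subseteq> {1..n}"
    using T by blast
  ultimately show ?thesis
    by (simp add: card_Diff_subset finite_subset)
qed

end

context fully_symmetric_model
begin

lemma influences_self_iff:
  assumes i: "i \<in> {1..n}"
  shows "influences M n C E i i \<longleftrightarrow> (\<exists>s\<in>{1..n}. p s \<noteq> p (n - s + 1))"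
proof
  assume "influences M n C E i i"
  then obtain x :: "nat \<Rightarrow> nat" where x: "x \<in> ({1..n} - {i}) \<rightarrow>\<^sub>E {0, 1}"
    and neq: "p (card {l \<in> {1..n}. (x(i := 0)) l = 0}) \<noteq>
              p (card {l \<in> {1..n}. (x(i := 1)) l = 1})"
    unfolding influences_iff[OF i i] fun_upd_same by blast
  define T where "T = {l \<in> {1..n} - {i}. x l = 0}"
  have T: "T \<subseteq> {1..n} - {i}"
    by (auto simp: T_def)
  have x_T: "x l = (if l \<in> T then 0 else 1)" if "l \<in> {1..n} - {i}" for l
    using PiE_mem[OF x that] that by (auto simp: T_def)
  \<comment> \<open>\<open>T\<close> misses \<open>i\<close>. The bound keeps
    \<open>s = Suc (card T)\<close> within \<open>n\<close>, so that the truncated subtraction in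
    \<open>n - s + 1\<close> is exact.\<close>
  have "card T \<le> n - 1"
    using card_mono[OF _ T] i by simp
  then have "Suc (card T) \<in> {1..n}" and "n - Suc (card T) + 1 = n - card T"
    using i by auto
  with neq show "\<exists>s\<in>{1..n}. p s \<noteq> p (n - s + 1)"
    by (intro bexI[of _ "Suc (card T)"])
      (simp_all only: card_zeros_upd_0[OF i T x_T] card_ones_upd_1[OF i T x_T] not_False_eq_True)
next
  assume "\<exists>s\<in>{1..n}. p s \<noteq> p (n - s + 1)"
  then obtain s where s: "s \<in> {1..n}" "p s \<noteq> p (n - s + 1)" by blast
  \<comment> \<open>Cause \<open>i\<close> in state 0 is itself the remaining one of the
    \<open>s\<close> zeros.\<close>
  have "s - 1 \<le> card ({1..n} - {i})"
    using s(1) i by auto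
  then obtain T where T: "T \<subseteq> {1..n} - {i}" "card T = s - 1"
    by (meson obtain_subset_with_card_n)
  define x :: "nat \<Rightarrow> nat" where "x = (\<lambda>l\<in>{1..n} - {i}. if l \<in> T then 0 else 1)"
  have x_T: "x l = (if l \<in> T then 0 else 1)" if "l \<in> {1..n} - {i}" for l
    using that by (simp add: x_def)
  have "x \<in> ({1..n} - {i}) \<rightarrow>\<^sub>E {0, 1}"
    by (auto simp: x_def)
  moreover have "Suc (card T) = s" and "n - card T = n - s + 1"
    using T(2) s(1) by auto
  ultimately show "influences M n C E i i"
    unfolding influences_iff[OF i i] fun_upd_same
    using s(2)
    by (intro bexI[of _ x])
      (simp_all only: card_zeros_upd_0[OF i T(1) x_T] card_ones_upd_1[OF i T(1) x_T] not_False_eq_True)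
qed

lemma influences_other:
  assumes i: "i \<in> {1..n}" and j: "j \<in> {1..n}" and "i \<noteq> j"
    and m: "1 \<le> m" "m < n" "p m \<noteq> p (Suc m)"
  shows "influences M n C E j i"
proof -
  \<comment> \<open>Cause \<open>i\<close> is to be one of \<open>m\<close> zeros; the other
    \<open>m - 1\<close> come from the \<open>n - 2\<close> indices besides \<open>i\<close> and
    \<open>j\<close>.\<close>
  have "m - 1 \<le> card ({1..n} - {j} - {i})"
    using m i j \<open>i \<noteq> j\<close> by simp
  then obtain S where S: "S \<subseteq> {1..n} - {j} - {i}" "card S = m - 1"
    by (meson obtain_subset_with_card_n)
  define T where "T = insert i S"
  have T: "T \<subseteq> {1..n} - {j}" and "i \<in> T"
    using S i \<open>i \<noteq> j\<close> by (auto simp: T_def)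
  have "finite S" "i \<notin> S"
    using S(1) by (auto intro: finite_subset)
  then have card_T: "card T = m"
    using S(2) m(1) by (simp add: T_def)
  define x :: "nat \<Rightarrow> nat" where "x = (\<lambda>l\<in>{1..n} - {j}. if l \<in> T then 0 else 1)"
  have x_T: "x l = (if l \<in> T then 0 else 1)" if "l \<in> {1..n} - {j}" for l
    using that by (simp add: x_def)
  have "x \<in> ({1..n} - {j}) \<rightarrow>\<^sub>E {0, 1}"
    by (auto simp: x_def)
  \<comment> \<open>Hence the parameter of \<open>E i\<close> counts zeros in both states of
    \<open>C j\<close>: \<open>m + 1\<close> of them for state 0 and \<open>m\<close> for state
    1.\<close>
  moreover have "(x(j := c)) i = 0" for c
    using x_T[of i] i \<open>i \<noteq> j\<close> \<open>i \<in> T\<close> by simp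
  ultimately show ?thesis
    unfolding influences_iff[OF i j]
    using m(3) card_T
    by (intro bexI[of _ x])
      (simp_all only: card_zeros_upd_0[OF j T x_T] card_zeros_upd_1[OF j T x_T] not_sym)
qed

lemma influences_all:
  assumes "s \<in> {1..n}" "p s \<noteq> p (n - s + 1)" and "i \<in> {1..n}" "j \<in> {1..n}"
  shows "influences M n C E j i"
proof (cases "i = j")
  case True
  then show ?thesis
    using influences_self_iff assms by blast
next
  case False
  \<comment> \<open>The index \<open>s\<close> and its mirror image may come in either order;
    \<open>a\<close> and \<open>b\<close> are the two of them sorted.\<close>
  have "n - s + 1 \<in> {1..n}"
    using assms(1) by auto
  then obtain a b where "a \<le> b" "a \<in> {1..n}" "b \<in> {1..n}" "p a \<noteq> p b"
    using assms(1,2) by (metis linorder_le_cases)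
  then obtain m where "1 \<le> m" "m < n" "p m \<noteq> p (Suc m)"
    using ex_consecutive_neq[of a b p] by (metis atLeastAtMost_iff le_trans less_le_trans)
  then show ?thesis
    using influences_other assms(3,4) False by blast
qed

end

theorem proposition3p1:
  fixes M :: "'a measure" and n :: nat and p :: "nat \<Rightarrow> real"
    and C E :: "nat \<Rightarrow> 'a \<Rightarrow> nat"
  assumes "n \<ge> 1"
    and "\<forall>k\<in>{1..n}. p k \<in> {0..1}"
    and "fully_symmetric_model M n p C E"
  shows "((\<forall>i\<in>{1..n}. influences M n C E i i) \<longleftrightarrow>
            (\<forall>i\<in>{1..n}. \<forall>j\<in>{1..n}. influences M n C E i j))
       \<and> ((\<forall>i\<in>{1..n}. \<forall>j\<in>{1..n}. influences M n C E i j) \<longleftrightarrow>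
            (\<exists>s\<in>{1..n}. p s \<noteq> p (n - s + 1)))"
proof -
  interpret fully_symmetric_model M n p C E
    by fact
  \<comment> \<open>Some index must exist to extract an \<open>s\<close> from the universally
    quantified influences, which would be vacuous over an empty range.\<close>
  have "1 \<in> {1..n}"
    using assms(1) by simp
  then show ?thesis
    using influences_self_iff influences_all by blast
qed

end
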